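(* Let $f$ be a continuous probability density on $\mathbb{R}$ such that $$\lim_{N\to\infty}\ \sum_{\substack{\ell=-\infty\\ \ell\neq 0}}^{\infty}\ \prod_{m=1}^{N}\mathcal{M}_f\!\left(1-\frac{2\pi i\ell}{\log 10}\right)=0 .$$ For each $n\ge1$ let $A=(a_{pq})$ be an $n\times n$ matrix whose entries are independent, identically distributed random variables with density $f$. For each permutation $\sigma$ of $\{1,\dots,n\}$ let $X_{\sigma,n}=\prod_{p=1}^n a_{p\sigma(p)}$ be the corresponding term (up to sign) in the determinant expansion of $A$. Then the distribution of the significands of the $n!$ terms converges in distribution to Benford's Law as $n\to\infty$: with $$P_n(s)=\frac1{n!}\sum_{\sigma}\varphi_s(X_{\sigma,n}),$$ for every $s\in[1,10)$ one has $\lim_{n\to\infty}\mathbb{E}[P_n(s)]=\log_{10}s$ and $\lim_{n\to\infty}\mathrm{Var}(P_n(s))=0$.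
   Context: Every $x>0$ is written uniquely as $x=S_{10}(x)\cdot 10^{k}$ with $k\in\mathbb{Z}$ and significand $S_{10}(x)\in[1,10)$; for $x<0$ the significand is that of $|x|$. For $s\in[1,10)$, $\varphi_s(x)=1$ if the significand of $x$ is at most $s$ and $\varphi_s(x)=0$ otherwise (the value at $x=0$ is irrelevant, as it occurs with probability $0$). The Mellin transform is $\mathcal{M}_f(s)=\int_0^\infty f(x)x^{s}\,\frac{dx}{x}$. *)

theory Defs
  imports "HOL-Probability.Probability"
begin

definition significand10 :: "real \<Rightarrow> real" where
  "significand10 x =
     (if x = 0 then 0
      else (THE t. t \<in> {1..<10} \<and> (\<exists>k::int. \<bar>x\<bar> = t * 10 powi k)))"

lemma significand10_ex1:
  fixes x :: real
  assumes "x \<noteq> 0"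
  shows "\<exists>!t. t \<in> {1..<10} \<and> (\<exists>k::int. \<bar>x\<bar> = t * 10 powi k)"
proof (rule ex_ex1I)
  define k where "k = \<lfloor>log 10 \<bar>x\<bar>\<rfloor>"
  have x: "\<bar>x\<bar> = 10 powr (log 10 \<bar>x\<bar>)"
    using assms by simp
  have "10 powr of_int k \<le> \<bar>x\<bar>" "\<bar>x\<bar> < 10 powr (of_int k + 1)"
    unfolding k_def by (subst x, rule powr_mono; simp; linarith) (subst (1) x, rule powr_less_mono; simp; linarith)
  then have "\<bar>x\<bar> / 10 powi k \<in> {1..<10}" "\<bar>x\<bar> = \<bar>x\<bar> / 10 powi k * 10 powi k"
    by (auto simp: powr_real_of_int' powr_add field_simps)
  then show "\<exists>t. t \<in> {1..<10} \<and> (\<exists>k::int. \<bar>x\<bar> = t * 10 powi k)"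
    by blast
next
  fix t u :: real
  have le: "j \<le> k" if "t \<in> {1..<10}" "u \<in> {1..<10}" "t * 10 powi j = u * 10 powi k"
    for t u :: real and j k :: int
  proof (rule ccontr)
    assume "\<not> j \<le> k"
    then have "(10::real) powi (k + 1) \<le> 10 powi j"
      by (intro power_int_increasing) auto
    also have "\<dots> \<le> t * 10 powi j"
      using mult_right_mono[of 1 t "10 powi j"] that(1) by simp
    also have "\<dots> < 10 * 10 powi k"
      unfolding that(3) using that(2) by (intro mult_strict_right_mono) auto
    finally show False
      by (simp add: power_int_add)
  qed
  assume "t \<in> {1..<10} \<and> (\<exists>k::int. \<bar>x\<bar> = t * 10 powi k)"
    and "u \<in> {1..<10} \<and> (\<exists>k::int. \<bar>x\<bar> = u * 10 powi k)"
  then obtain j k :: int where *: "t \<in> {1..<10}" "u \<in> {1..<10}"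
      "\<bar>x\<bar> = t * 10 powi j" "\<bar>x\<bar> = u * 10 powi k"
    by blast
  then have "j = k"
    using le[of t u j k] le[of u t k j] by simp
  with * show "t = u"
    by simp
qed

definition benford_phi :: "real \<Rightarrow> real \<Rightarrow> real" where
  "benford_phi s x = (if significand10 x \<le> s then 1 else 0)"

definition mellin :: "(real \<Rightarrow> real) \<Rightarrow> complex \<Rightarrow> complex" where
  "mellin f s =
     (LINT x:{0<..}|lborel. complex_of_real (f x) * complex_of_real x powr s / complex_of_real x)"

text \<open>Convergence of a bilateral series without its zeroth term: both one-sided series
  converge, possibly only conditionally. This is weaker than \<^const>\<open>has_sum\<close> over the
  nonzero integers, which means unconditional convergence.\<close>

definition nonzero_int_sums :: "(int \<Rightarrow> complex) \<Rightarrow> complex \<Rightarrow> bool" where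
  "nonzero_int_sums c S \<longleftrightarrow>
     (\<exists>Sp Sn. (\<lambda>k::nat. c (int k + 1)) sums Sp \<and> (\<lambda>k::nat. c (- (int k + 1))) sums Sn
        \<and> S = Sp + Sn)"

definition det_term ::
  "nat \<Rightarrow> (nat \<Rightarrow> nat \<Rightarrow> 'a \<Rightarrow> real) \<Rightarrow> (nat \<Rightarrow> nat) \<Rightarrow> 'a \<Rightarrow> real" where
  "det_term n A \<sigma> \<omega> = (\<Prod>p=1..n. A p (\<sigma> p) \<omega>)"

definition det_term_cdf ::
  "nat \<Rightarrow> (nat \<Rightarrow> nat \<Rightarrow> 'a \<Rightarrow> real) \<Rightarrow> real \<Rightarrow> 'a \<Rightarrow> real" where
  "det_term_cdf n A s \<omega> =
     (1 / fact n) * (\<Sum>\<sigma> | \<sigma> permutes {1..n}. benford_phi s (det_term n A \<sigma> \<omega>))"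

end

theory Submission
  imports Defs
begin

text \<open>Let \<open>Z\<^sub>\<sigma>\<close> be the decimal logarithm of the absolute value of the term belonging to \<open>\<sigma>\<close>; the
  claim is that the \<open>n!\<close> numbers \<open>Z\<^sub>\<sigma>\<close> are asymptotically equidistributed modulo 1, in mean. By
  Weyl's criterion it suffices that, for every \<open>k \<noteq> 0\<close>, the average \<open>F\<close> of the phases
  \<open>exp (2 \<pi> i k Z\<^sub>\<sigma>)\<close> tends to 0 in \<open>L\<^sup>1\<close>. Expanding \<open>E \<bar>F\<bar>\<^sup>2\<close> over pairs \<open>(\<sigma>, \<tau>)\<close>, the positions
  where \<open>\<sigma>\<close> and \<open>\<tau>\<close> agree cancel, and by independence each other position contributes a factor
  of modulus at most \<open>\<rho> = \<bar>E exp (2 \<pi> i k log\<^sub>1\<^sub>0 \<bar>X\<bar>)\<bar>\<close>, which is smaller than 1 since the entries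
  have a density. Two permutations agree at one position on average, so convexity of \<open>r ^ x\<close>
  bounds the expansion by \<open>r ^ n + 1 / n\<close> for any \<open>r\<close> between \<open>\<rho>\<close> and 1.\<close>

subsection \<open>Weyl's criterion for random empirical measures\<close>

text \<open>Lebesgue measure on one period; under \<open>t \<mapsto> cis (2 * pi * t)\<close> it
  becomes the uniform measure of the circle.\<close>

abbreviation unit_interval :: "real measure" where
  "unit_interval \<equiv> restrict_space lborel {0..1}"

lemma prob_space_unit_interval: "prob_space unit_interval"
  by (rule prob_space_restrict_space) auto

lemma integrable_unit_interval:
  fixes h :: "real \<Rightarrow> real"
  assumes "continuous_on UNIV h"
  shows "integrable unit_interval h"
  using borel_integrable_atLeastAtMost'[of 0 1 h] continuous_on_subset[OF assms]
  by (simp add: integrable_restrict_space set_integrable_def)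

section \<open>Trigonometric polynomials and their density on the circle\<close>

lemma cis_2pi_eq_iff: "cis (2 * pi * x) = cis (2 * pi * y) \<longleftrightarrow> (\<exists>k::int. x = y + of_int k)"
proof -
  have "cis (2 * pi * x) = cis (2 * pi * y) \<longleftrightarrow> (\<exists>k::int. 2 * pi * x = 2 * pi * y + 2 * pi * k)"
    using sin_cos_eq_iff[of "2 * pi * x" "2 * pi * y"] by (auto simp: complex_eq_iff)
  also have "\<dots> \<longleftrightarrow> (\<exists>k::int. 2 * pi * x = 2 * pi * (y + of_int k))"
    by (simp only: distrib_left)
  finally show ?thesis
    by simp
qed

lemma cis_2pi_frac: "cis (2 * pi * frac x) = cis (2 * pi * x)"
  unfolding cis_2pi_eq_iff by (rule exI[of _ "-\<lfloor>x\<rfloor>"]) (simp add: frac_def)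

text \<open>Real parts with complex coefficients cover sines, cosines and constants at once.
  Generating by sums alone keeps later inductions to single characters; closure under products is
  derived.\<close>

inductive trig_poly :: "(real \<Rightarrow> real) \<Rightarrow> bool" where
  monomial: "trig_poly (\<lambda>t. Re (c * cis (2 * pi * of_int k * t)))"
| add: "trig_poly f \<Longrightarrow> trig_poly g \<Longrightarrow> trig_poly (\<lambda>t. f t + g t)"

lemma trig_poly_const: "trig_poly (\<lambda>_. c)"
  using trig_poly.monomial[of "of_real c" 0] by simp

text \<open>The product-to-sum formulas in complex form, since \<open>Re a\<close> is the mean of
  \<open>a\<close> and \<open>cnj a\<close>.\<close>

lemma Re_mult_Re: "Re a * Re b = Re (a * b / 2) + Re (a * cnj b / 2)"
  by (simp add: field_simps)

text \<open>Multiplying two monomials yields the frequencies \<open>k + l\<close> and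
  \<open>k - l\<close>; being integers, they stay within the class. This supplies the ring structure
  for Stone-Weierstrass.\<close>

lemma trig_poly_mult:
  assumes "trig_poly f" "trig_poly g"
  shows "trig_poly (\<lambda>t. f t * g t)"
  using assms(1)
proof induction
  case (monomial c k)
  show ?case
    using assms(2)
  proof induction
    case (monomial d l)
    have "Re (c * cis (2 * pi * of_int k * t)) * Re (d * cis (2 * pi * of_int l * t)) =
        Re (c * d / 2 * cis (2 * pi * of_int (k + l) * t)) +
        Re (c * cnj d / 2 * cis (2 * pi * of_int (k - l) * t))" for t
    proof -
      have "cis (2 * pi * of_int (k + l) * t)
          = cis (2 * pi * of_int k * t) * cis (2 * pi * of_int l * t)"
        "cis (2 * pi * of_int (k - l) * t)
          = cis (2 * pi * of_int k * t) * cnj (cis (2 * pi * of_int l * t))"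
        by (simp_all add: cis_mult cis_cnj algebra_simps)
      then show ?thesis
        by (simp only: Re_mult_Re complex_cnj_mult) (simp add: mult_ac del: times_complex.sel)
    qed
    then show ?case
      using trig_poly.add[OF trig_poly.monomial trig_poly.monomial,
          of "c * d / 2" "k + l" "c * cnj d / 2" "k - l"] by presburger
  next
    case (add f g)
    then show ?case
      using trig_poly.add by (simp only: distrib_left)
  qed
next
  case (add f1 f2)
  then show ?case
    using trig_poly.add by (simp only: distrib_right)
qed

text \<open>Stone-Weierstrass on the compact circle. Passing to the circle makes periodicity
  automatic, and \<open>Re\<close> and \<open>Im\<close> already separate points.\<close>

lemma trig_poly_dense:
  fixes g :: "complex \<Rightarrow> real"
  assumes "continuous_on (sphere 0 1) g" "\<epsilon> > 0"
  obtains T where "trig_poly T" "\<And>t. \<bar>g (cis (2 * pi * t)) - T t\<bar> < \<epsilon>"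
proof -
  define R where
    "R = {h :: complex \<Rightarrow> real. continuous_on (sphere 0 1) h \<and> trig_poly (\<lambda>t. h (cis (2 * pi * t)))}"
  interpret function_ring_on R "sphere 0 1"
  proof
    fix x y :: complex
    assume "x \<noteq> y"
    have "Re \<in> R"
      using trig_poly.monomial[of 1 1] by (auto simp: R_def intro!: continuous_intros)
    \<comment> \<open>The coefficient \<open>-\<i>\<close> turns the real part into a sine.\<close>
    moreover have "Im \<in> R"
      using trig_poly.monomial[of "-\<i>" 1] by (auto simp: R_def intro!: continuous_intros)
    ultimately show "\<exists>f\<in>R. f x \<noteq> f y"
      using \<open>x \<noteq> y\<close> complex_eq_iff by blast
  qed (auto simp: R_def trig_poly.add trig_poly_mult trig_poly_const intro!: continuous_intros)
  obtain h where "h \<in> R" "\<forall>x\<in>sphere 0 1. \<bar>g x - h x\<bar> < \<epsilon>"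
    using Stone_Weierstrass_basic[OF assms] by blast
  then show ?thesis
    using that[of "\<lambda>t. h (cis (2 * pi * t))"] by (auto simp: R_def)
qed

lemma continuous_on_trig_poly: "trig_poly T \<Longrightarrow> continuous_on UNIV T"
  by (induction rule: trig_poly.induct) (auto intro!: continuous_intros)

text \<open>A nonconstant character has a periodic antiderivative, so the values at both ends of the
  period cancel.\<close>

lemma integral_unit_interval_character:
  fixes k :: int
  assumes "k \<noteq> 0"
  shows "(LINT t|unit_interval. Re (c * cis (2 * pi * of_int k * t))) = 0"
proof -
  \<comment> \<open>Since \<open>Im (\<i> * z) = Re z\<close>, differentiating the imaginary part
    returns the integrand.\<close>
  define F where "F t = Im (c * cis (2 * pi * of_int k * t)) / (2 * pi * of_int k)" for t
  have "(LINT t|lborel. indicator {0..1} t *\<^sub>R Re (c * cis (2 * pi * of_int k * t))) = F 1 - F 0"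
  proof (rule integral_FTC_atLeastAtMost)
    fix x :: real
    have "(F has_real_derivative Re (c * cis (2 * pi * of_int k * x))) (at x)"
      unfolding F_def using assms
      by (auto intro!: derivative_eq_intros simp: field_simps)
    then show "(F has_vector_derivative Re (c * cis (2 * pi * of_int k * x))) (at x within {0..1})"
      by (simp add: has_real_derivative_iff_has_vector_derivative has_vector_derivative_at_within)
  qed (auto intro!: continuous_intros)
  also have "cis (2 * pi * of_int k) = 1"
    using cis_2pi_eq_iff[of "of_int k" 0] by simp
  then have "F 1 - F 0 = 0"
    by (simp add: F_def)
  finally show ?thesis
    by (simp add: integral_restrict_space set_lebesgue_integral_def del: times_complex.sel)
qed

section \<open>Empirical averages\<close>

text \<open>A triangular array: sample space and index set may change with \<open>n\<close>, and
  nothing is assumed about the joint law of the samples. The probabilistic input comes in later, as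
  decay of the averaged characters.\<close>

locale empirical_measures =
  fixes M :: "nat \<Rightarrow> 'a measure" and I :: "nat \<Rightarrow> 'i set" and Z :: "nat \<Rightarrow> 'i \<Rightarrow> 'a \<Rightarrow> real"
  assumes prob: "prob_space (M n)"
    and fin: "finite (I n)" "I n \<noteq> {}"
    and meas: "i \<in> I n \<Longrightarrow> Z n i \<in> borel_measurable (M n)"
begin

text \<open>The value type is kept general because complex characters and real test functions are
  both averaged.\<close>

definition emp :: "nat \<Rightarrow> (real \<Rightarrow> 'b::real_normed_vector) \<Rightarrow> 'a \<Rightarrow> 'b" where
  "emp n h \<omega> = (\<Sum>i\<in>I n. h (Z n i \<omega>)) /\<^sub>R card (I n)"

lemma emp_mono:
  fixes h :: "real \<Rightarrow> real"
  assumes "\<And>t. h t \<le> h' t"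
  shows "emp n h \<omega> \<le> emp n h' \<omega>"
  unfolding emp_def using assms by (intro scaleR_left_mono sum_mono) auto

lemma emp_add: "emp n (\<lambda>t. h t + h' t) \<omega> = emp n h \<omega> + emp n h' \<omega>"
  by (simp add: emp_def sum.distrib scaleR_add_right)

lemma emp_const: "emp n (\<lambda>_. c) \<omega> = c"
  using fin[of n] by (simp add: emp_def scaleR_conv_of_real sum_constant_scaleR)

lemma borel_measurable_emp:
  fixes h :: "real \<Rightarrow> 'b::{second_countable_topology, real_normed_vector}"
  assumes [measurable]: "h \<in> borel_measurable borel"
  shows "emp n h \<in> borel_measurable (M n)"
  unfolding emp_def using meas[of _ n] by measurable

lemma norm_emp_le:
  assumes "\<And>t. norm (h t) \<le> B"
  shows "norm (emp n h \<omega>) \<le> B"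
proof -
  have "norm (\<Sum>i\<in>I n. h (Z n i \<omega>)) \<le> card (I n) * B"
    using sum_norm_le[of "I n" "\<lambda>i. h (Z n i \<omega>)" "\<lambda>_. B"] assms by simp
  then show ?thesis
    using fin[of n] by (simp add: emp_def field_simps card_gt_0_iff)
qed

lemma integrable_emp:
  fixes h :: "real \<Rightarrow> 'b::{second_countable_topology, banach}"
  assumes "h \<in> borel_measurable borel" "\<And>t. norm (h t) \<le> B"
  shows "integrable (M n) (emp n h)"
proof -
  interpret prob_space "M n"
    by (rule prob)
  show ?thesis
    by (rule integrable_const_bound[of _ B])
      (use norm_emp_le[of h B n] assms(2) borel_measurable_emp[OF assms(1)] in auto)
qed

definition deviation :: "(real \<Rightarrow> real) \<Rightarrow> nat \<Rightarrow> 'a \<Rightarrow> real" where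
  "deviation h n \<omega> = \<bar>emp n h \<omega> - (LINT t|unit_interval. h t)\<bar>"

text \<open>Convergence in mean, rather than of expectations alone, so that expectation and variance
  can both be read off in the end.\<close>

definition equidistributes :: "(real \<Rightarrow> real) \<Rightarrow> bool" where
  "equidistributes h \<longleftrightarrow> (\<lambda>n. LINT \<omega>|M n. deviation h n \<omega>) \<longlonglongrightarrow> 0"

lemma expected_deviation_nonneg: "0 \<le> (LINT \<omega>|M n. deviation h n \<omega>)"
  by (auto simp: deviation_def)

lemma equidistributes_if_le:
  assumes "\<And>n. (LINT \<omega>|M n. deviation h n \<omega>) \<le> u n" "u \<longlonglongrightarrow> 0"
  shows "equidistributes h"
  unfolding equidistributes_def
  by (rule tendsto_sandwich[OF _ _ tendsto_const assms(2)])
    (auto intro: always_eventually expected_deviation_nonneg assms(1))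

lemma integrable_deviation:
  assumes "h \<in> borel_measurable borel" "\<And>t. \<bar>h t\<bar> \<le> B"
  shows "integrable (M n) (deviation h n)"
proof -
  interpret prob_space "M n"
    by (rule prob)
  show ?thesis
    unfolding deviation_def using integrable_emp[of h B n] assms by auto
qed

end

section \<open>From characters to continuous test functions\<close>

lemma trig_poly_bounded: "trig_poly T \<Longrightarrow> \<exists>B. \<forall>t. \<bar>T t\<bar> \<le> B"
proof (induction rule: trig_poly.induct)
  case (monomial c k)
  then show ?case
    using abs_Re_le_cmod[of "c * cis _"] by (auto simp: norm_mult simp del: times_complex.sel)
next
  case (add f g)
  then obtain A B where "\<forall>t. \<bar>f t\<bar> \<le> A" "\<forall>t. \<bar>g t\<bar> \<le> B"
    by blast
  then show ?case
    by (intro exI[of _ "A + B"]) (auto intro: abs_triangle_ineq[THEN order_trans] add_mono)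
qed

context empirical_measures
begin

text \<open>Constants have no deviation; other monomials have integral 0 and deviate by at most a
  multiple of the averaged character; sums follow from the triangle inequality.\<close>

lemma equidistributes_trig_poly:
  assumes characters: "\<And>k::int. k \<noteq> 0 \<Longrightarrow>
      (\<lambda>n. LINT \<omega>|M n. cmod (emp n (\<lambda>t. cis (2 * pi * of_int k * t)) \<omega>)) \<longlonglongrightarrow> 0"
    and "trig_poly T"
  shows "equidistributes T"
  using assms(2)
proof induction
  case (monomial c k)
  show ?case
  proof (cases "k = 0")
    case True
    then show ?thesis
      using prob_space.prob_space[OF prob_space_unit_interval]
      by (simp add: equidistributes_def deviation_def emp_const)
  next
    case False
    let ?e = "\<lambda>t. cis (2 * pi * of_int k * t)"
    have [measurable]: "?e \<in> borel_measurable borel"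
      by (intro borel_measurable_continuous_onI continuous_intros)
    have lim: "(\<lambda>n. cmod c * (LINT \<omega>|M n. cmod (emp n ?e \<omega>))) \<longlonglongrightarrow> 0"
      using tendsto_mult_right_zero[OF characters[OF False]] .
    have le: "deviation (\<lambda>t. Re (c * ?e t)) n \<omega> \<le> cmod c * cmod (emp n ?e \<omega>)" for n \<omega>
    proof -
      have "emp n (\<lambda>t. Re (c * ?e t)) \<omega> = Re (c * emp n ?e \<omega>)"
        unfolding emp_def by (simp add: sum_distrib_left Re_sum del: times_complex.sel)
      then show ?thesis
        unfolding deviation_def integral_unit_interval_character[OF False]
        using abs_Re_le_cmod[of "c * emp n ?e \<omega>"] by (simp add: norm_mult del: times_complex.sel)
    qed
    have "integrable (M n) (\<lambda>\<omega>. cmod c * cmod (emp n ?e \<omega>))" for n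
      using integrable_emp[of ?e 1 n] by auto
    moreover have "integrable (M n) (deviation (\<lambda>t. Re (c * ?e t)) n)" for n
      using abs_Re_le_cmod[of "c * ?e _"]
      by (intro integrable_deviation[of _ "cmod c"])
        (auto simp: norm_mult simp del: times_complex.sel)
    ultimately have "(LINT \<omega>|M n. deviation (\<lambda>t. Re (c * ?e t)) n \<omega>)
        \<le> (LINT \<omega>|M n. cmod c * cmod (emp n ?e \<omega>))" for n
      by (intro integral_mono le)
    then have "(LINT \<omega>|M n. deviation (\<lambda>t. Re (c * ?e t)) n \<omega>)
        \<le> cmod c * (LINT \<omega>|M n. cmod (emp n ?e \<omega>))" for n
      by (simp only: integral_mult_right_zero)
    then show ?thesis
      using lim by (rule equidistributes_if_le)
  qed
next
  case (add f g)
  note meas = borel_measurable_continuous_onI[OF continuous_on_trig_poly]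
  have int: "integrable (M n) (deviation T n)" if T: "trig_poly T" for T n
    using integrable_deviation[OF meas[OF T]] trig_poly_bounded[OF T] by blast
  have "deviation (\<lambda>t. f t + g t) n \<omega> \<le> deviation f n \<omega> + deviation g n \<omega>" for n \<omega>
    using add by (simp add: deviation_def emp_add integrable_unit_interval continuous_on_trig_poly)
  then have "(LINT \<omega>|M n. deviation (\<lambda>t. f t + g t) n \<omega>)
      \<le> (LINT \<omega>|M n. deviation f n \<omega> + deviation g n \<omega>)" for n
    by (intro integral_mono Bochner_Integration.integrable_add int add.hyps trig_poly.add)
  then have le: "(LINT \<omega>|M n. deviation (\<lambda>t. f t + g t) n \<omega>)
      \<le> (LINT \<omega>|M n. deviation f n \<omega>) + (LINT \<omega>|M n. deviation g n \<omega>)" for n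
    by (simp only: Bochner_Integration.integral_add int add.hyps)
  have lim: "(\<lambda>n. (LINT \<omega>|M n. deviation f n \<omega>) + (LINT \<omega>|M n. deviation g n \<omega>)) \<longlonglongrightarrow> 0"
    using add.IH tendsto_add_zero unfolding equidistributes_def by blast
  show ?case
    using le lim by (rule equidistributes_if_le)
qed

text \<open>Uniform approximation by a trigonometric polynomial \<open>T\<close>, valid for all
  \<open>n\<close> and all outcomes at once, transfers convergence from \<open>T\<close> to
  \<open>g\<close>.\<close>

lemma equidistributes_circle_function:
  fixes g :: "complex \<Rightarrow> real"
  assumes characters: "\<And>k::int. k \<noteq> 0 \<Longrightarrow>
      (\<lambda>n. LINT \<omega>|M n. cmod (emp n (\<lambda>t. cis (2 * pi * of_int k * t)) \<omega>)) \<longlonglongrightarrow> 0"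
    and g: "continuous_on (sphere 0 1) g"
  shows "equidistributes (\<lambda>t. g (cis (2 * pi * t)))"
  unfolding equidistributes_def
proof (rule LIMSEQ_I)
  fix \<epsilon> :: real
  assume "\<epsilon> > 0"
  let ?h = "\<lambda>t. g (cis (2 * pi * t))"
  have h: "continuous_on UNIV ?h"
    by (rule continuous_on_compose2[OF g]) (auto intro!: continuous_intros)
  obtain T where T: "trig_poly T" "\<And>t. \<bar>?h t - T t\<bar> < \<epsilon> / 4"
    using trig_poly_dense[OF g, of "\<epsilon> / 4"] \<open>\<epsilon> > 0\<close> by auto
  obtain B where B: "\<And>t. \<bar>T t\<bar> \<le> B"
    using trig_poly_bounded[OF T(1)] by blast
  have Bh: "\<bar>?h t\<bar> \<le> B + \<epsilon> / 4" for t
    using B[of t] T(2)[of t] by linarith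
  note [measurable] = borel_measurable_continuous_onI[OF h]
    borel_measurable_continuous_onI[OF continuous_on_trig_poly[OF T(1)]]
  have close_mean: "\<bar>(LINT t|unit_interval. ?h t) - (LINT t|unit_interval. T t)\<bar> \<le> \<epsilon> / 4"
  proof -
    interpret U: prob_space unit_interval
      by (rule prob_space_unit_interval)
    have "(LINT t|unit_interval. ?h t) - (LINT t|unit_interval. T t)
        = (LINT t|unit_interval. ?h t - T t)"
      using integrable_unit_interval[OF h]
        integrable_unit_interval[OF continuous_on_trig_poly[OF T(1)]] by simp
    also have "\<bar>\<dots>\<bar> \<le> (LINT t|unit_interval. \<bar>?h t - T t\<bar>)"
      by (rule integral_abs_bound)
    also have "\<dots> \<le> (LINT t|unit_interval. \<epsilon> / 4)"
      using T(2) integrable_unit_interval[OF h]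
        integrable_unit_interval[OF continuous_on_trig_poly[OF T(1)]]
      by (intro integral_mono) (auto intro: less_imp_le)
    finally show ?thesis
      using U.prob_space by simp
  qed
  have close_emp: "\<bar>emp n ?h \<omega> - emp n T \<omega>\<bar> \<le> \<epsilon> / 4" for n \<omega>
  proof -
    have "emp n ?h \<omega> - emp n T \<omega> = emp n (\<lambda>t. ?h t - T t) \<omega>"
      by (simp add: emp_def sum_subtractf right_diff_distrib)
    then show ?thesis
      using norm_emp_le[of "\<lambda>t. ?h t - T t" "\<epsilon> / 4" n \<omega>] T(2) by (auto intro: less_imp_le)
  qed
  \<comment> \<open>Empirical mean and integral each move by at most \<open>\<epsilon> / 4\<close>
    when \<open>T\<close> replaces \<open>?h\<close>.\<close>
  have dev: "deviation ?h n \<omega> \<le> deviation T n \<omega> + \<epsilon> / 2" for n \<omega>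
    unfolding deviation_def using close_mean close_emp[of n \<omega>] by linarith
  have le: "(LINT \<omega>|M n. deviation ?h n \<omega>) \<le> (LINT \<omega>|M n. deviation T n \<omega>) + \<epsilon> / 2" for n
  proof -
    interpret prob_space "M n"
      by (rule prob)
    have "(LINT \<omega>|M n. deviation ?h n \<omega>) \<le> (LINT \<omega>|M n. deviation T n \<omega> + \<epsilon> / 2)"
      using integrable_deviation[of ?h "B + \<epsilon> / 4" n] integrable_deviation[of T B n] Bh B
      by (intro integral_mono dev Bochner_Integration.integrable_add) auto
    also have "\<dots> = (LINT \<omega>|M n. deviation T n \<omega>) + \<epsilon> / 2"
      using integrable_deviation[of T B n] B prob_space by simp
    finally show ?thesis .
  qed
  have "(\<lambda>n. LINT \<omega>|M n. deviation T n \<omega>) \<longlonglongrightarrow> 0"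
    using equidistributes_trig_poly[OF characters T(1)] unfolding equidistributes_def .
  then obtain N where N: "\<And>n. n \<ge> N \<Longrightarrow> \<bar>LINT \<omega>|M n. deviation T n \<omega>\<bar> < \<epsilon> / 2"
    using LIMSEQ_D[of "\<lambda>n. LINT \<omega>|M n. deviation T n \<omega>" 0 "\<epsilon> / 2"] \<open>\<epsilon> > 0\<close> by auto
  have "norm ((LINT \<omega>|M n. deviation ?h n \<omega>) - 0) < \<epsilon>" if "n \<ge> N" for n
    using le[of n] N[OF that] expected_deviation_nonneg[of n ?h] by simp
  then show "\<exists>N. \<forall>n\<ge>N. norm ((LINT \<omega>|M n. deviation ?h n \<omega>) - 0) < \<epsilon>"
    by blast
qed

end

section \<open>Arcs and their continuous majorants\<close>

text \<open>The cut-offs \<open>max 0 (1 - k * infdist z K)\<close> decrease to the indicator of the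
  closed set \<open>K\<close>, so dominated convergence brings their integrals down to the measure.
  As \<open>infdist\<close> to the empty set is 0 by convention, \<open>K\<close> is nonempty.
  Minorants of an arc will come from majorants of the complementary arc.\<close>

lemma closed_upper_approximation:
  assumes "closed K" "K \<noteq> {}" "measure unit_interval {t \<in> {0..1}. cis (2 * pi * t) \<in> K} \<le> m" "\<epsilon> > 0"
  obtains g :: "complex \<Rightarrow> real" where "continuous_on UNIV g" "\<And>z. 0 \<le> g z" "\<And>z. g z \<le> 1"
    "\<And>z. z \<in> K \<Longrightarrow> g z = 1" "(LINT t|unit_interval. g (cis (2 * pi * t))) < m + \<epsilon>"
proof -
  interpret U: prob_space unit_interval
    by (rule prob_space_unit_interval)
  define g where "g k z = max 0 (1 - real k * infdist z K)" for k z
  have g: "continuous_on UNIV (g k)" "0 \<le> g k z" "g k z \<le> 1" for k z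
    unfolding g_def by (auto intro!: continuous_intros simp: infdist_nonneg)
  have one: "g k z = 1" if "z \<in> K" for k z
    using that by (simp add: g_def)
  have "(\<lambda>k. g k z) \<longlonglongrightarrow> indicator K z" for z
  proof (cases "z \<in> K")
    case True
    then show ?thesis
      by (simp add: one)
  next
    case False
    then have "infdist z K > 0"
      using assms(1,2) in_closed_iff_infdist_zero infdist_nonneg[of z K] by fastforce
    then obtain N where "1 < real N * infdist z K"
      using ex_less_of_nat_mult by blast
    moreover have "real N * infdist z K \<le> real k * infdist z K" if "k \<ge> N" for k
      using that by (intro mult_right_mono infdist_nonneg) simp
    ultimately have "1 - real k * infdist z K \<le> 0" if "k \<ge> N" for k
      using that by fastforce
    then have "\<forall>\<^sub>F k in sequentially. g k z = indicator K z"
      using False by (intro eventually_sequentiallyI[of N]) (simp add: g_def)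
    then show ?thesis
      by (rule tendsto_eventually)
  qed
  moreover have [measurable]: "K \<in> sets borel"
    using assms(1) by simp
  moreover have [measurable]: "(\<lambda>t. cis (2 * pi * t)) \<in> borel_measurable borel"
    by (intro borel_measurable_continuous_onI continuous_intros)
  moreover have [measurable]: "g k \<in> borel_measurable borel" for k
    by (intro borel_measurable_continuous_onI g)
  moreover have "(\<lambda>t. indicator K (cis (2 * pi * t)) :: real) \<in> borel_measurable unit_interval"
      "(\<lambda>t. g k (cis (2 * pi * t))) \<in> borel_measurable unit_interval" for k
    by (intro measurable_restrict_space1; measurable)+
  ultimately have "(\<lambda>k. LINT t|unit_interval. g k (cis (2 * pi * t)))
      \<longlonglongrightarrow> (LINT t|unit_interval. indicator K (cis (2 * pi * t)))"
    using g by (intro integral_dominated_convergence[where w="\<lambda>_. 1"]) auto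
  moreover have "(LINT t|unit_interval. indicator K (cis (2 * pi * t)))
      = (LINT t|unit_interval. indicator {t \<in> {0..1}. cis (2 * pi * t) \<in> K} t :: real)"
    by (intro Bochner_Integration.integral_cong) (auto simp: space_restrict_space indicator_def)
  moreover have "\<dots> = measure unit_interval ({t \<in> {0..1}. cis (2 * pi * t) \<in> K} \<inter> space unit_interval)"
    by (rule Bochner_Integration.integral_indicator)
  moreover have "\<dots> \<le> m"
    using assms(3) by (subst Int_absorb2) (auto simp: space_restrict_space)
  ultimately have "\<forall>\<^sub>F k in sequentially. (LINT t|unit_interval. g k (cis (2 * pi * t))) < m + \<epsilon>"
    using \<open>\<epsilon> > 0\<close> by (intro order_tendstoD(2)) auto
  then obtain k where "(LINT t|unit_interval. g k (cis (2 * pi * t))) < m + \<epsilon>"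
    by (auto simp: eventually_sequentially)
  then show ?thesis
    using that[of "g k"] g one by blast
qed

lemma closed_arc: "closed ((\<lambda>t. cis (2 * pi * t)) ` {a..b})"
  by (intro compact_imp_closed compact_continuous_image continuous_intros) auto

text \<open>The end points \<open>0\<close> and \<open>1\<close> of the unit interval are the same point of the circle, so the
  preimage of an arc may exceed the interval by a null set.\<close>

lemma measure_arc:
  assumes "0 \<le> a" "a \<le> b" "b \<le> 1"
  shows "measure unit_interval {t \<in> {0..1}. cis (2 * pi * t) \<in> (\<lambda>t. cis (2 * pi * t)) ` {a..b}}
    \<le> b - a" (is "measure _ ?K \<le> _")
proof -
  have "?K \<subseteq> {a..b} \<union> {0, 1}"
  proof (rule subsetI, rule ccontr)
    fix t
    assume "t \<in> ?K" "t \<notin> {a..b} \<union> {0, 1}"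
    then obtain u where *: "t \<in> {0..1}" "u \<in> {a..b}" "cis (2 * pi * t) = cis (2 * pi * u)"
        "t \<notin> {a..b}" "t \<noteq> 1" "t \<noteq> 0"
      by auto
    then obtain k :: int where k: "t = u + of_int k"
      using cis_2pi_eq_iff by blast
    \<comment> \<open>Here \<open>t\<close> lies strictly between 0 and 1 while \<open>u\<close>
      lies in the closed interval, so they differ by less than 1.\<close>
    then have "- 1 < real_of_int k" "real_of_int k < 1"
      using * assms by auto
    then have "k = 0"
      by linarith
    then show False
      using * k by simp
  qed
  moreover have "?K \<subseteq> {0..1}"
    by blast
  moreover have "{a..b} \<subseteq> {0..1}"
    using assms by auto
  moreover have K: "?K \<in> sets lborel"
  proof -
    have "closed ({0..1} \<inter> (\<lambda>t. cis (2 * pi * t)) -` ((\<lambda>t. cis (2 * pi * t)) ` {a..b}))"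
      by (intro continuous_closed_preimage closed_arc continuous_intros closed_atLeastAtMost)
    then show ?thesis
      by (simp add: vimage_def Int_def)
  qed
  ultimately have "measure unit_interval ?K = measure lborel ?K"
    by (intro measure_restrict_space) auto
  also have "\<dots> \<le> measure lborel ({a..b} \<union> {0, 1})"
    using \<open>?K \<subseteq> {a..b} \<union> {0, 1}\<close> K
      emeasure_bounded_finite[of "{a..b}"] emeasure_bounded_finite[of "{0, 1 :: real}"]
    by (intro measure_mono_fmeasurable fmeasurable.Un) (auto simp: fmeasurable_def)
  also have "\<dots> \<le> measure lborel {a..b} + measure lborel {0, 1::real}"
    by (intro measure_Un_le) auto
  also have "measure lborel {0, 1::real} = 0"
    by (intro measure_eq_0_null_sets finite_imp_null_set_lborel) auto
  finally show ?thesis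
    using assms by simp
qed

text \<open>The test function jumps, so it is squeezed between continuous ones: a majorant
  \<open>g\<close> of the arc \<open>[0, c]\<close>, and \<open>1 - h\<close> with \<open>h\<close>
  a majorant of the arc \<open>[c, 1]\<close>. The integral of \<open>g\<close> exceeds
  \<open>c\<close>, and that of \<open>1 - h\<close> falls short of it, by less than
  \<open>\<epsilon> / 3\<close>.\<close>

theorem (in empirical_measures) weyl_criterion:
  assumes characters: "\<And>k::int. k \<noteq> 0 \<Longrightarrow>
      (\<lambda>n. LINT \<omega>|M n. cmod (emp n (\<lambda>t. cis (2 * pi * of_int k * t)) \<omega>)) \<longlonglongrightarrow> 0"
    and c: "0 \<le> c" "c \<le> 1"
  shows "(\<lambda>n. LINT \<omega>|M n. \<bar>emp n (\<lambda>t. of_bool (frac t \<le> c)) \<omega> - c\<bar>) \<longlonglongrightarrow> 0"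
proof (rule LIMSEQ_I)
  fix \<epsilon> :: real
  assume "\<epsilon> > 0"
  define arc where "arc a b = (\<lambda>t. cis (2 * pi * t)) ` {a..b}" for a b
  let ?\<phi> = "\<lambda>t. of_bool (frac t \<le> c) :: real"
  obtain g where g: "continuous_on UNIV g" "\<And>z. 0 \<le> g z" "\<And>z. g z \<le> 1"
      "\<And>z. z \<in> arc 0 c \<Longrightarrow> g z = 1" "(LINT t|unit_interval. g (cis (2 * pi * t))) < c + \<epsilon> / 3"
    by (rule closed_upper_approximation[of "arc 0 c" c "\<epsilon> / 3"])
      (use closed_arc[of 0 c] measure_arc[of 0 c] c \<open>\<epsilon> > 0\<close> in \<open>auto simp: arc_def\<close>)
  obtain h where h: "continuous_on UNIV h" "\<And>z. 0 \<le> h z" "\<And>z. h z \<le> 1"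
      "\<And>z. z \<in> arc c 1 \<Longrightarrow> h z = 1" "(LINT t|unit_interval. h (cis (2 * pi * t))) < 1 - c + \<epsilon> / 3"
    by (rule closed_upper_approximation[of "arc c 1" "1 - c" "\<epsilon> / 3"])
      (use closed_arc[of c 1] measure_arc[of c 1] c \<open>\<epsilon> > 0\<close> in \<open>auto simp: arc_def\<close>)
  define g' h' where "g' t = g (cis (2 * pi * t))" and "h' t = h (cis (2 * pi * t))" for t
  note defs = g'_def h'_def
  have bound: "\<bar>g' t\<bar> \<le> 1" "\<bar>h' t\<bar> \<le> 1" for t
    using g(2,3)[of "cis (2 * pi * t)"] h(2,3)[of "cis (2 * pi * t)"] by (auto simp: defs)
  have "continuous_on UNIV g'" "continuous_on UNIV h'"
    unfolding defs
    by (rule continuous_on_compose2[OF g(1)] continuous_on_compose2[OF h(1)];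
        intro continuous_intros subset_UNIV)+
  then have meas: "g' \<in> borel_measurable borel" "h' \<in> borel_measurable borel"
    by (auto intro: borel_measurable_continuous_onI)
  have [measurable]: "?\<phi> \<in> borel_measurable borel"
    by (simp add: frac_def)
  \<comment> \<open>\<open>frac t\<close> and \<open>t\<close> name the same point of the circle;
    when \<open>frac t > c\<close>, it lies on the second arc.\<close>
  have \<phi>_le: "?\<phi> t \<le> g' t" "1 \<le> ?\<phi> t + h' t" for t
  proof -
    have mem: "cis (2 * pi * t) \<in> arc a b" if "frac t \<in> {a..b}" for a b
      unfolding arc_def cis_2pi_frac[of t, symmetric] using that by (rule imageI)
    show "?\<phi> t \<le> g' t"
      using mem[of 0 c] g(2,4)[of "cis (2 * pi * t)"] by (auto simp: defs)
    show "1 \<le> ?\<phi> t + h' t"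
      using mem[of c 1] h(2,4)[of "cis (2 * pi * t)"] frac_lt_1[of t] by (auto simp: defs)
  qed
  \<comment> \<open>\<open>g'\<close> controls the error from above and \<open>h'\<close> from
    below; deviations are nonnegative, so their sum serves both sides.\<close>
  have le: "\<bar>emp n ?\<phi> \<omega> - c\<bar> \<le> deviation g' n \<omega> + deviation h' n \<omega> + \<epsilon> / 3" for n \<omega>
  proof -
    have "emp n ?\<phi> \<omega> \<le> emp n g' \<omega>" "1 \<le> emp n ?\<phi> \<omega> + emp n h' \<omega>"
      using emp_mono[of ?\<phi> g' n \<omega>] emp_mono[of "\<lambda>_. 1" "\<lambda>t. ?\<phi> t + h' t" n \<omega>] \<phi>_le
      by (simp_all add: emp_const emp_add)
    then show ?thesis
      using g(5) h(5) unfolding deviation_def defs by linarith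
  qed
  have int: "(LINT \<omega>|M n. \<bar>emp n ?\<phi> \<omega> - c\<bar>)
      \<le> (LINT \<omega>|M n. deviation g' n \<omega>) + (LINT \<omega>|M n. deviation h' n \<omega>) + \<epsilon> / 3" for n
  proof -
    interpret prob_space "M n"
      by (rule prob)
    note dev = integrable_deviation[OF meas(1) bound(1), of n]
      integrable_deviation[OF meas(2) bound(2), of n]
    have "(LINT \<omega>|M n. \<bar>emp n ?\<phi> \<omega> - c\<bar>)
        \<le> (LINT \<omega>|M n. deviation g' n \<omega> + deviation h' n \<omega> + \<epsilon> / 3)"
      using integrable_emp[of ?\<phi> 1 n] dev by (intro integral_mono le) auto
    also have "\<dots> = (LINT \<omega>|M n. deviation g' n \<omega>) + (LINT \<omega>|M n. deviation h' n \<omega>) + \<epsilon> / 3"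
      using dev prob_space by simp
    finally show ?thesis .
  qed
  have "(\<lambda>n. LINT \<omega>|M n. deviation g' n \<omega>) \<longlonglongrightarrow> 0" "(\<lambda>n. LINT \<omega>|M n. deviation h' n \<omega>) \<longlonglongrightarrow> 0"
    using equidistributes_circle_function[OF characters continuous_on_subset[OF g(1) subset_UNIV]]
      equidistributes_circle_function[OF characters continuous_on_subset[OF h(1) subset_UNIV]]
    by (simp_all add: equidistributes_def g'_def[abs_def] h'_def[abs_def])
  from tendsto_add_zero[OF this]
  have "\<forall>\<^sub>F n in sequentially.
      (LINT \<omega>|M n. deviation g' n \<omega>) + (LINT \<omega>|M n. deviation h' n \<omega>) < \<epsilon> / 3"
    using \<open>\<epsilon> > 0\<close> by (intro order_tendstoD(2)) auto
  then obtain N where N: "\<And>n. n \<ge> N \<Longrightarrow>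
      (LINT \<omega>|M n. deviation g' n \<omega>) + (LINT \<omega>|M n. deviation h' n \<omega>) < \<epsilon> / 3"
    by (auto simp: eventually_sequentially)
  have "norm ((LINT \<omega>|M n. \<bar>emp n ?\<phi> \<omega> - c\<bar>) - 0) < \<epsilon>" if "n \<ge> N" for n
    using int[of n] N[OF that] \<open>\<epsilon> > 0\<close> by simp
  then show "\<exists>N. \<forall>n\<ge>N. norm ((LINT \<omega>|M n. \<bar>emp n ?\<phi> \<omega> - c\<bar>) - 0) < \<epsilon>"
    by blast
qed

subsection \<open>Fourier coefficients of the determinant terms\<close>

text \<open>The logarithm of \<open>\<bar>x\<bar>\<close> is confined to an arithmetic progression
  of step \<open>2 * pi / \<theta>\<close>, which leaves two points per term.\<close>

lemma countable_log_phase: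
  assumes "\<theta> \<noteq> 0"
  shows "countable {x :: real. cis (\<theta> * ln \<bar>x\<bar>) = u}"
proof (cases "\<exists>a. u = cis a")
  case True
  then obtain a where u: "u = cis a"
    by blast
  define e where "e k = exp ((a + 2 * pi * of_int k) / \<theta>)" for k :: int
  \<comment> \<open>The point 0 is added because \<open>ln\<close> takes a conventional value
    there.\<close>
  have "{x. cis (\<theta> * ln \<bar>x\<bar>) = u} \<subseteq> {0} \<union> range e \<union> range (\<lambda>k. - e k)"
  proof (rule subsetI, rule ccontr)
    fix x
    assume "x \<in> {x. cis (\<theta> * ln \<bar>x\<bar>) = u}" "x \<notin> {0} \<union> range e \<union> range (\<lambda>k. - e k)"
    then have *: "cis (\<theta> * ln \<bar>x\<bar>) = u" "x \<notin> range (\<lambda>k. - e k)" "x \<notin> range e" "x \<noteq> 0"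
      by auto
    then obtain k :: int where "\<theta> * ln \<bar>x\<bar> = a + 2 * pi * of_int k"
      unfolding u using sin_cos_eq_iff[of "\<theta> * ln \<bar>x\<bar>" a] by (auto simp: complex_eq_iff)
    then have "ln \<bar>x\<bar> = (a + 2 * pi * of_int k) / \<theta>"
      using assms by (simp add: field_simps)
    then have "\<bar>x\<bar> = e k"
      unfolding e_def using \<open>x \<noteq> 0\<close> by (metis exp_ln zero_less_abs_iff)
    then have "x = e k \<or> x = - e k"
      by linarith
    then show False
      using * by blast
  qed
  then show ?thesis
    by (rule countable_subset) auto
next
  case False
  then show ?thesis
    by (metis (mono_tags, lifting) Collect_empty_eq countable_empty)
qed

text \<open>Equality in the triangle inequality would force the phase to be almost surely constant,
  hence \<open>X\<close> to live on a countable set.\<close>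

lemma (in prob_space) norm_log_character_less_1:
  fixes f :: "real \<Rightarrow> ennreal"
  assumes D: "distributed M lborel X f" and "\<theta> \<noteq> 0"
  shows "cmod (expectation (\<lambda>\<omega>. cis (\<theta> * ln \<bar>X \<omega>\<bar>))) < 1"
proof (rule ccontr)
  have [measurable]: "X \<in> borel_measurable M"
    using distributed_measurable[OF D] by simp
  have [measurable]: "cis \<in> borel_measurable borel"
    by (intro borel_measurable_continuous_onI continuous_intros)
  define w where "w \<omega> = cis (\<theta> * ln \<bar>X \<omega>\<bar>)" for \<omega>
  have [measurable]: "w \<in> borel_measurable M"
    unfolding w_def by measurable
  have int: "integrable M w"
    by (rule integrable_const_bound[of _ 1]) (auto simp: w_def)
  have "cmod (expectation w) \<le> 1"
    using integral_norm_bound[of M w] prob_space by (simp add: w_def)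
  moreover assume "\<not> cmod (expectation (\<lambda>\<omega>. cis (\<theta> * ln \<bar>X \<omega>\<bar>))) < 1"
  ultimately have norm: "cmod (expectation w) = 1"
    by (simp add: w_def[abs_def])
  define u where "u = expectation w"
  \<comment> \<open>For numbers of modulus 1 the squared distance is affine in \<open>w\<close>, so
    its expectation can be computed from \<open>u = expectation w\<close>; it vanishes.\<close>
  have "expectation (\<lambda>\<omega>. cmod (u - w \<omega>) ^ 2) = expectation (\<lambda>\<omega>. 2 - 2 * Re (cnj u * w \<omega>))"
  proof (intro Bochner_Integration.integral_cong refl)
    fix \<omega>
    have "cmod u ^ 2 = 1" "cmod (w \<omega>) ^ 2 = 1"
      using norm by (simp_all add: u_def w_def)
    then show "cmod (u - w \<omega>) ^ 2 = 2 - 2 * Re (cnj u * w \<omega>)"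
      unfolding cmod_power2 by (simp add: power2_eq_square algebra_simps)
  qed
  also have "\<dots> = 2 - 2 * Re (cnj u * u)"
    using int prob_space by (simp add: u_def del: times_complex.sel)
  also have "Re (cnj u * u) = 1"
    using norm cmod_power2[of u] by (simp add: u_def power2_eq_square)
  finally have "expectation (\<lambda>\<omega>. cmod (u - w \<omega>) ^ 2) = 0"
    by simp
  moreover have "integrable M (\<lambda>\<omega>. cmod (u - w \<omega>) ^ 2)"
  proof (rule integrable_const_bound[of _ 4])
    have "cmod (u - w \<omega>) \<le> 2" for \<omega>
      using norm_triangle_ineq4[of u "w \<omega>"] norm by (simp add: u_def w_def)
    then show "AE \<omega> in M. norm (cmod (u - w \<omega>) ^ 2) \<le> 4"
      using power_mono[of "cmod (u - w _)" 2 2] by simp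
  qed auto
  ultimately have "AE \<omega> in M. cmod (u - w \<omega>) ^ 2 = 0"
    by (subst integral_nonneg_eq_0_iff_AE[symmetric]) auto
  then have "AE \<omega> in M. cis (\<theta> * ln \<bar>X \<omega>\<bar>) = u"
    by eventually_elim (simp add: w_def)
  then have "AE x in lborel. 0 < f x \<longrightarrow> cis (\<theta> * ln \<bar>x\<bar>) = u"
    using distributed_AE2[OF D, of "\<lambda>x. cis (\<theta> * ln \<bar>x\<bar>) = u"] by simp
  \<comment> \<open>A countable set is null, so the density must vanish almost everywhere, against
    its total mass 1.\<close>
  moreover have "AE x in lborel. cis (\<theta> * ln \<bar>x\<bar>) \<noteq> u"
    using countable_imp_null_set_lborel[OF countable_log_phase[OF assms(2), of u]]
    by (intro AE_I') auto
  ultimately have "AE x in lborel. f x = 0"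
    by eventually_elim (auto simp: zero_less_iff_neq_zero)
  moreover have "f \<in> borel_measurable lborel"
    using distributed_borel_measurable[OF D] .
  ultimately have "(\<integral>\<^sup>+x. f x \<partial>lborel) = 0"
    using nn_integral_0_iff_AE[of f lborel] by simp
  moreover have "(\<integral>\<^sup>+x. f x \<partial>lborel) = emeasure (distr M lborel X) UNIV"
    using distributed_distr_eq_density[OF D] \<open>f \<in> borel_measurable lborel\<close>
    by (simp add: emeasure_density)
  moreover have "emeasure (distr M lborel X) UNIV = 1"
    using emeasure_space_1 by (simp add: emeasure_distr)
  ultimately show False
    by simp
qed

section \<open>Agreements of two permutations\<close>

text \<open>Composing with the transposition of \<open>a\<close> and \<open>b\<close> identifies
  these permutations with those of \<open>S - {a}\<close>.\<close>

lemma card_permutes_mapping: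
  assumes "finite S" "a \<in> S" "b \<in> S"
  shows "card {\<tau>. \<tau> permutes S \<and> \<tau> a = b} = fact (card S - 1)"
proof -
  define T where "T = S - {a}"
  have S: "S = insert a T" and "a \<notin> T" "finite T"
    using assms by (auto simp: T_def)
  have fix_a: "\<pi> a = a" if "\<pi> permutes T" for \<pi>
    using permutes_not_in[OF that \<open>a \<notin> T\<close>] .
  have "{\<tau>. \<tau> permutes S \<and> \<tau> a = b} = (\<lambda>\<pi>. Transposition.transpose a b \<circ> \<pi>) ` {\<pi>. \<pi> permutes T}"
  proof (intro equalityI subsetI)
    fix \<tau>
    assume "\<tau> \<in> {\<tau>. \<tau> permutes S \<and> \<tau> a = b}"
    then have "\<tau> \<in> {\<tau>. \<tau> permutes insert a T}" "\<tau> a = b"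
      by (auto simp: S)
    then obtain b' \<pi> where *: "\<tau> = Transposition.transpose a b' \<circ> \<pi>" "\<pi> permutes T"
      unfolding permutes_insert by auto
    then have "b' = b"
      using \<open>\<tau> a = b\<close> fix_a[OF *(2)] by simp
    then show "\<tau> \<in> (\<lambda>\<pi>. Transposition.transpose a b \<circ> \<pi>) ` {\<pi>. \<pi> permutes T}"
      using * by blast
  next
    fix \<tau>
    assume "\<tau> \<in> (\<lambda>\<pi>. Transposition.transpose a b \<circ> \<pi>) ` {\<pi>. \<pi> permutes T}"
    then obtain \<pi> where *: "\<tau> = Transposition.transpose a b \<circ> \<pi>" "\<pi> permutes T"
      by blast
    have "\<tau> \<in> {\<tau>. \<tau> permutes insert a T}"
      unfolding permutes_insert using * assms(3) by (auto simp: S)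
    then show "\<tau> \<in> {\<tau>. \<tau> permutes S \<and> \<tau> a = b}"
      using *(1) fix_a[OF *(2)] by (simp add: S)
  qed
  moreover have "inj_on (\<lambda>\<pi>. Transposition.transpose a b \<circ> \<pi>) {\<pi>. \<pi> permutes T}"
    by (metis (no_types, lifting) inj_onI comp_assoc transpose_comp_involutory id_comp)
  ultimately show ?thesis
    using card_permutations[OF refl \<open>finite T\<close>] assms by (simp add: card_image T_def)
qed

text \<open>Double counting: at each position \<open>p\<close>, the value \<open>\<sigma> p\<close>
  is taken by \<open>fact (card S - 1)\<close> permutations. Hence there is one agreement on
  average; the empty set is separate because \<open>fact 0 = 1\<close>.\<close>

lemma sum_agreements:
  assumes "finite S" "\<sigma> permutes S"
  shows "(\<Sum>\<tau> | \<tau> permutes S. card {p \<in> S. \<sigma> p = \<tau> p}) = (if S = {} then 0 else fact (card S))"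
proof -
  have fin: "finite {\<tau>. \<tau> permutes S}"
    using assms(1) by (rule finite_permutations)
  have "(\<Sum>\<tau> | \<tau> permutes S. card {p \<in> S. \<sigma> p = \<tau> p})
      = (\<Sum>\<tau> | \<tau> permutes S. \<Sum>p\<in>S. if \<sigma> p = \<tau> p then 1 else 0)"
    using assms by (intro sum.cong refl) (simp add: sum.If_cases Int_def)
  also have "\<dots> = (\<Sum>p\<in>S. \<Sum>\<tau> | \<tau> permutes S. if \<sigma> p = \<tau> p then 1 else 0)"
    by (rule sum.swap)
  also have "\<dots> = (\<Sum>p\<in>S. card {\<tau>. \<tau> permutes S \<and> \<tau> p = \<sigma> p})"
    using fin by (intro sum.cong refl) (auto simp: sum.If_cases intro!: arg_cong[of _ _ card])
  also have "\<dots> = (\<Sum>p\<in>S. fact (card S - 1))"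
    using assms permutes_in_image[OF assms(2)] by (intro sum.cong refl card_permutes_mapping) auto
  finally show ?thesis
    using assms by (simp add: fact_reduce card_gt_0_iff)
qed

section \<open>Mean square of the averaged phases\<close>

text \<open>The exponent \<open>n - a\<close> is a convex combination of \<open>n\<close> and 0,
  with weight \<open>a / n\<close> on 0, and exponentials are convex. Being linear in
  \<open>a\<close>, the bound can be averaged over permutations by
  \<open>sum_agreements\<close>.\<close>

lemma power_diff_le_chord:
  fixes r :: real
  assumes "0 < r" "a \<le> n" "n > 0"
  shows "r ^ (n - a) \<le> r ^ n + a / n"
proof -
  define t where "t = real a / real n"
  have t: "0 \<le> t" "t \<le> 1"
    using assms by (auto simp: t_def)
  have "r ^ (n - a) = exp (real (n - a) * ln r)"
    using assms exp_of_nat_mult[of "n - a" "ln r"] by (simp del: of_nat_diff)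
  also have "real (n - a) * ln r = (1 - t) *\<^sub>R (n * ln r) + t *\<^sub>R 0"
    using assms by (simp add: t_def field_simps of_nat_diff)
  also have "exp \<dots> \<le> (1 - t) * exp (n * ln r) + t * exp 0"
    by (rule convex_onD[OF exp_convex]) (use t in auto)
  also have "exp (n * ln r) = r ^ n"
    using assms by (simp add: exp_of_nat_mult)
  also have "(1 - t) * r ^ n + t * exp 0 \<le> r ^ n + t"
    using t assms by (simp add: algebra_simps)
  finally show ?thesis
    by (simp add: t_def)
qed

text \<open>Extending the product over the whole grid by trivial factors makes independence directly
  applicable; where \<open>\<sigma>\<close> and \<open>\<tau>\<close> agree, the two phases cancel.\<close>

lemma (in prob_space) norm_expectation_phase_difference_le:
  fixes Y :: "'i \<times> 'i \<Rightarrow> 'a \<Rightarrow> real"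
  assumes indep: "indep_vars (\<lambda>_. borel) Y (I \<times> I)" and "finite I"
    and \<rho>: "\<And>j. j \<in> I \<times> I \<Longrightarrow> cmod (expectation (\<lambda>\<omega>. cis (\<theta> * Y j \<omega>))) \<le> \<rho>" "0 \<le> \<rho>"
    and maps: "\<sigma> ` I \<subseteq> I" "\<tau> ` I \<subseteq> I"
  shows "cmod (expectation (\<lambda>\<omega>. cis (\<theta> * ((\<Sum>p\<in>I. Y (p, \<sigma> p) \<omega>) - (\<Sum>p\<in>I. Y (p, \<tau> p) \<omega>)))))
    \<le> \<rho> ^ card {p \<in> I. \<sigma> p \<noteq> \<tau> p}"
proof -
  define G where "G j y = (if snd j = \<sigma> (fst j) then cis (\<theta> * y) else 1) *
      (if snd j = \<tau> (fst j) then cis (- \<theta> * y) else 1)" for j :: "'i \<times> 'i" and y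
  have [measurable]: "cis \<in> borel_measurable borel"
    by (intro borel_measurable_continuous_onI continuous_intros)
  have G_meas [measurable]: "G j \<in> borel_measurable borel" for j
    unfolding G_def by (cases "snd j = \<sigma> (fst j)"; cases "snd j = \<tau> (fst j)") simp_all
  have norm_G: "cmod (G j y) = 1" for j y
    by (simp add: G_def norm_mult)
  have Y_meas: "Y j \<in> borel_measurable M" if "j \<in> I \<times> I" for j
    using indep that by (auto simp: indep_vars_def)
  have cis_sum: "cis (\<theta> * (\<Sum>p\<in>I. y p)) = (\<Prod>p\<in>I. cis (\<theta> * y p))" for \<theta> and y :: "'i \<Rightarrow> real"
    using \<open>finite I\<close> by (induction I rule: finite_induct) (simp_all add: distrib_left flip: cis_mult)
  have "cis (\<theta> * ((\<Sum>p\<in>I. Y (p, \<sigma> p) \<omega>) - (\<Sum>p\<in>I. Y (p, \<tau> p) \<omega>))) = (\<Prod>j\<in>I \<times> I. G j (Y j \<omega>))" for \<omega>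
  proof -
    have "(\<Prod>j\<in>I \<times> I. G j (Y j \<omega>)) = (\<Prod>p\<in>I. \<Prod>q\<in>I. G (p, q) (Y (p, q) \<omega>))"
      by (simp add: prod.cartesian_product case_prod_unfold)
    also have "\<dots> = (\<Prod>p\<in>I. cis (\<theta> * Y (p, \<sigma> p) \<omega>) * cis (- \<theta> * Y (p, \<tau> p) \<omega>))"
      using maps \<open>finite I\<close>
      by (intro prod.cong refl) (auto simp: G_def prod.distrib prod.delta image_subset_iff)
    also have "\<dots> = cis (\<theta> * (\<Sum>p\<in>I. Y (p, \<sigma> p) \<omega>)) * cis (- \<theta> * (\<Sum>p\<in>I. Y (p, \<tau> p) \<omega>))"
      by (simp only: prod.distrib cis_sum)
    finally show ?thesis
      by (simp add: cis_mult right_diff_distrib)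
  qed
  then have "expectation (\<lambda>\<omega>. cis (\<theta> * ((\<Sum>p\<in>I. Y (p, \<sigma> p) \<omega>) - (\<Sum>p\<in>I. Y (p, \<tau> p) \<omega>))))
      = expectation (\<lambda>\<omega>. \<Prod>j\<in>I \<times> I. G j (Y j \<omega>))"
    by simp
  also have "\<dots> = (\<Prod>j\<in>I \<times> I. expectation (\<lambda>\<omega>. G j (Y j \<omega>)))"
  proof (rule indep_vars_lebesgue_integral)
    show "indep_vars (\<lambda>_. borel) (\<lambda>j \<omega>. G j (Y j \<omega>)) (I \<times> I)"
      using indep G_meas by (rule indep_vars_compose2)
    show "integrable M (\<lambda>\<omega>. G j (Y j \<omega>))" if "j \<in> I \<times> I" for j
      using Y_meas[OF that] by (intro integrable_const_bound[of _ 1]) (auto simp: norm_G)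
  qed (use \<open>finite I\<close> in auto)
  also have "cmod \<dots> = (\<Prod>p\<in>I. \<Prod>q\<in>I. cmod (expectation (\<lambda>\<omega>. G (p, q) (Y (p, q) \<omega>))))"
    by (simp add: prod_norm prod.cartesian_product case_prod_unfold flip: prod_norm)
  also have "\<dots> \<le> (\<Prod>p\<in>I. if \<sigma> p \<noteq> \<tau> p then \<rho> else 1)"
  proof (intro prod_mono conjI prod_nonneg)
    fix p
    assume "p \<in> I"
    have le_1: "cmod (expectation (\<lambda>\<omega>. G (p, q) (Y (p, q) \<omega>))) \<le> 1" for q
      using integral_norm_bound[of M "\<lambda>\<omega>. G (p, q) (Y (p, q) \<omega>)"] prob_space by (simp add: norm_G)
    show "(\<Prod>q\<in>I. cmod (expectation (\<lambda>\<omega>. G (p, q) (Y (p, q) \<omega>)))) \<le> (if \<sigma> p \<noteq> \<tau> p then \<rho> else 1)"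
    proof (cases "\<sigma> p = \<tau> p")
      case True
      then show ?thesis
        using le_1 by (auto intro!: prod_le_1)
    next
      case False
      have "\<sigma> p \<in> I"
        using maps(1) \<open>p \<in> I\<close> by blast
      \<comment> \<open>In a row where the permutations differ, two cells carry phases; the one of
        \<open>\<sigma>\<close> gives \<open>\<rho>\<close>, all other factors are bounded by
        1.\<close>
      have "(\<Prod>q\<in>I. cmod (expectation (\<lambda>\<omega>. G (p, q) (Y (p, q) \<omega>))))
          = cmod (expectation (\<lambda>\<omega>. G (p, \<sigma> p) (Y (p, \<sigma> p) \<omega>))) *
            (\<Prod>q\<in>I - {\<sigma> p}. cmod (expectation (\<lambda>\<omega>. G (p, q) (Y (p, q) \<omega>))))"
        using \<open>finite I\<close> \<open>\<sigma> p \<in> I\<close> by (rule prod.remove)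
      also have "\<dots> \<le> \<rho> * 1"
      proof (intro mult_mono)
        show "cmod (expectation (\<lambda>\<omega>. G (p, \<sigma> p) (Y (p, \<sigma> p) \<omega>))) \<le> \<rho>"
          using \<rho>(1)[of "(p, \<sigma> p)"] False \<open>p \<in> I\<close> \<open>\<sigma> p \<in> I\<close> by (simp add: G_def)
      qed (use le_1 \<rho>(2) in \<open>auto intro!: prod_le_1 prod_nonneg\<close>)
      finally show ?thesis
        using False by simp
    qed
  qed simp
  also have "\<dots> = \<rho> ^ card {p \<in> I. \<sigma> p \<noteq> \<tau> p}"
    using \<open>finite I\<close> by (simp add: prod.If_cases Int_def)
  finally show ?thesis .
qed

text \<open>The bound is proved for the second moment, where phase differences over pairs of
  permutations factor by independence, and passes to the mean by a square root. Positivity of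
  \<open>r\<close> lets its powers be written as exponentials.\<close>

lemma (in prob_space) expectation_norm_permutation_average_le:
  fixes Y :: "'i \<times> 'i \<Rightarrow> 'a \<Rightarrow> real"
  assumes indep: "indep_vars (\<lambda>_. borel) Y (I \<times> I)" and "finite I" "I \<noteq> {}"
    and r: "\<And>j. j \<in> I \<times> I \<Longrightarrow> cmod (expectation (\<lambda>\<omega>. cis (\<theta> * Y j \<omega>))) \<le> r" "0 < r"
  shows "expectation (\<lambda>\<omega>. cmod ((\<Sum>\<sigma> | \<sigma> permutes I. cis (\<theta> * (\<Sum>p\<in>I. Y (p, \<sigma> p) \<omega>))) /\<^sub>R fact (card I)))
    \<le> sqrt (r ^ card I + 1 / card I)" (is "expectation (\<lambda>\<omega>. cmod (?F \<omega>)) \<le> _")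
proof -
  let ?P = "{\<sigma>. \<sigma> permutes I}" and ?n = "card I"
  have P: "finite ?P" "card ?P = fact ?n"
    using \<open>finite I\<close> by (auto simp: finite_permutations card_permutations)
  have "?n > 0"
    using assms(2,3) by (simp add: card_gt_0_iff)
  define y where "y \<sigma> \<omega> = (\<Sum>p\<in>I. Y (p, \<sigma> p) \<omega>)" for \<sigma> \<omega>
  have [measurable]: "cis \<in> borel_measurable borel"
    by (intro borel_measurable_continuous_onI continuous_intros)
  have y_meas: "y \<sigma> \<in> borel_measurable M" if "\<sigma> permutes I" for \<sigma>
    unfolding y_def using indep permutes_in_image[OF that]
    by (intro borel_measurable_sum) (auto simp: indep_vars_def)
  have F_meas: "?F \<in> borel_measurable M"
    unfolding y_def[symmetric] using y_meas by measurable
  have F_le: "cmod (?F \<omega>) \<le> 1" for \<omega>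
    using norm_sum[of "\<lambda>\<sigma>. cis (\<theta> * y \<sigma> \<omega>)" ?P] P by (simp add: y_def field_simps)
  have int: "integrable M (\<lambda>\<omega>. cmod (?F \<omega>))" "integrable M (\<lambda>\<omega>. cmod (?F \<omega>) ^ 2)"
    using measurable_compose[OF F_meas borel_measurable_norm]
      borel_measurable_power[OF measurable_compose[OF F_meas borel_measurable_norm]] F_le
    by (auto intro!: integrable_const_bound[of _ 1] simp: power_le_one simp del: norm_scaleR)
  have int_cis: "integrable M (\<lambda>\<omega>. cis (\<theta> * (y \<sigma> \<omega> - y \<tau> \<omega>)))" if "\<sigma> \<in> ?P" "\<tau> \<in> ?P" for \<sigma> \<tau>
    using that y_meas[of \<sigma>] y_meas[of \<tau>] by (intro integrable_const_bound[of _ 1]) auto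
  have "complex_of_real (cmod (?F \<omega>) ^ 2)
      = (\<Sum>\<sigma>\<in>?P. \<Sum>\<tau>\<in>?P. cis (\<theta> * (y \<sigma> \<omega> - y \<tau> \<omega>))) / fact ?n ^ 2" for \<omega>
  proof -
    have "complex_of_real (cmod (?F \<omega>) ^ 2) = ?F \<omega> * cnj (?F \<omega>)"
      by (rule complex_norm_square)
    also have "\<dots> = (\<Sum>\<sigma>\<in>?P. cis (\<theta> * y \<sigma> \<omega>)) * (\<Sum>\<tau>\<in>?P. cis (- (\<theta> * y \<tau> \<omega>))) / fact ?n ^ 2"
      by (simp add: y_def cnj_sum cis_cnj scaleR_conv_of_real power2_eq_square divide_simps)
    also have "\<dots> = (\<Sum>\<sigma>\<in>?P. \<Sum>\<tau>\<in>?P. cis (\<theta> * (y \<sigma> \<omega> - y \<tau> \<omega>))) / fact ?n ^ 2"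
      by (simp add: sum_product cis_mult right_diff_distrib)
    finally show ?thesis .
  qed
  then have "complex_of_real (expectation (\<lambda>\<omega>. cmod (?F \<omega>) ^ 2))
      = expectation (\<lambda>\<omega>. (\<Sum>\<sigma>\<in>?P. \<Sum>\<tau>\<in>?P. cis (\<theta> * (y \<sigma> \<omega> - y \<tau> \<omega>))) / fact ?n ^ 2)"
    by (simp only: flip: integral_complex_of_real)
  also have "\<dots> = (\<Sum>\<sigma>\<in>?P. \<Sum>\<tau>\<in>?P. expectation (\<lambda>\<omega>. cis (\<theta> * (y \<sigma> \<omega> - y \<tau> \<omega>)))) / fact ?n ^ 2"
  proof -
    have "expectation (\<lambda>\<omega>. \<Sum>\<sigma>\<in>?P. \<Sum>\<tau>\<in>?P. cis (\<theta> * (y \<sigma> \<omega> - y \<tau> \<omega>)))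
        = (\<Sum>\<sigma>\<in>?P. expectation (\<lambda>\<omega>. \<Sum>\<tau>\<in>?P. cis (\<theta> * (y \<sigma> \<omega> - y \<tau> \<omega>))))"
      by (intro Bochner_Integration.integral_sum Bochner_Integration.integrable_sum int_cis)
    also have "\<dots> = (\<Sum>\<sigma>\<in>?P. \<Sum>\<tau>\<in>?P. expectation (\<lambda>\<omega>. cis (\<theta> * (y \<sigma> \<omega> - y \<tau> \<omega>))))"
      by (intro sum.cong refl Bochner_Integration.integral_sum int_cis)
    finally show ?thesis
      by (simp only: integral_divide_zero)
  qed
  finally have "cmod (complex_of_real (expectation (\<lambda>\<omega>. cmod (?F \<omega>) ^ 2)))
      \<le> (\<Sum>\<sigma>\<in>?P. \<Sum>\<tau>\<in>?P. cmod (expectation (\<lambda>\<omega>. cis (\<theta> * (y \<sigma> \<omega> - y \<tau> \<omega>))))) / fact ?n ^ 2"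
    by (auto simp: norm_divide norm_power intro!: divide_right_mono sum_norm_le norm_sum)
  also have "\<dots> \<le> (\<Sum>\<sigma>\<in>?P. \<Sum>\<tau>\<in>?P. r ^ ?n + card {p \<in> I. \<sigma> p = \<tau> p} / ?n) / fact ?n ^ 2"
  proof (intro divide_right_mono sum_mono)
    fix \<sigma> \<tau>
    assume "\<sigma> \<in> ?P" "\<tau> \<in> ?P"
    then have "cmod (expectation (\<lambda>\<omega>. cis (\<theta> * (y \<sigma> \<omega> - y \<tau> \<omega>)))) \<le> r ^ card {p \<in> I. \<sigma> p \<noteq> \<tau> p}"
      unfolding y_def using r permutes_image[of _ I]
      by (intro norm_expectation_phase_difference_le[OF indep \<open>finite I\<close>]) auto
    also have "{p \<in> I. \<sigma> p \<noteq> \<tau> p} = I - {p \<in> I. \<sigma> p = \<tau> p}"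
      by blast
    also have "card \<dots> = ?n - card {p \<in> I. \<sigma> p = \<tau> p}"
      using \<open>finite I\<close> by (intro card_Diff_subset) auto
    also have "r ^ \<dots> \<le> r ^ ?n + card {p \<in> I. \<sigma> p = \<tau> p} / ?n"
      using \<open>finite I\<close> by (intro power_diff_le_chord[OF r(2) _ \<open>?n > 0\<close>] card_mono) auto
    finally show "cmod (expectation (\<lambda>\<omega>. cis (\<theta> * (y \<sigma> \<omega> - y \<tau> \<omega>))))
        \<le> r ^ ?n + card {p \<in> I. \<sigma> p = \<tau> p} / ?n" .
  qed simp
  \<comment> \<open>The agreement counts sum to \<open>fact ?n\<close> for each
    \<open>\<sigma>\<close>, so on average they contribute exactly \<open>1 / ?n\<close>.\<close>
  also have "\<dots> = r ^ ?n + 1 / ?n"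
  proof -
    have "(\<Sum>\<tau>\<in>?P. r ^ ?n + card {p \<in> I. \<sigma> p = \<tau> p} / ?n) = fact ?n * (r ^ ?n + 1 / ?n)"
      if "\<sigma> \<in> ?P" for \<sigma>
    proof -
      have "(\<Sum>\<tau>\<in>?P. card {p \<in> I. \<sigma> p = \<tau> p}) = fact ?n"
        using sum_agreements[OF \<open>finite I\<close>, of \<sigma>] that \<open>I \<noteq> {}\<close> by simp
      then have "(\<Sum>\<tau>\<in>?P. real (card {p \<in> I. \<sigma> p = \<tau> p})) = fact ?n"
        by (simp flip: of_nat_sum)
      then show ?thesis
        using P by (simp add: sum.distrib distrib_left flip: sum_divide_distrib)
    qed
    then show ?thesis
      using P by (simp add: power2_eq_square)
  qed
  finally have "expectation (\<lambda>\<omega>. cmod (?F \<omega>) ^ 2) \<le> r ^ ?n + 1 / ?n"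
    by (simp only: norm_of_real)
  moreover have "(expectation (\<lambda>\<omega>. cmod (?F \<omega>))) ^ 2 \<le> expectation (\<lambda>\<omega>. cmod (?F \<omega>) ^ 2)"
    using variance_eq[OF int] variance_positive[of "\<lambda>\<omega>. cmod (?F \<omega>)"] by linarith
  ultimately show ?thesis
    by (intro real_le_rsqrt) linarith
qed

subsection \<open>Significands\<close>

text \<open>Splitting the logarithm into integer and fractional part gives an admissible
  representation, and uniqueness does the rest.\<close>

lemma significand10_eq:
  assumes "x \<noteq> 0"
  shows "significand10 x = 10 powr frac (log 10 \<bar>x\<bar>)"
proof -
  have "10 powr frac (log 10 \<bar>x\<bar>) * 10 powi \<lfloor>log 10 \<bar>x\<bar>\<rfloor>
      = 10 powr (frac (log 10 \<bar>x\<bar>) + of_int \<lfloor>log 10 \<bar>x\<bar>\<rfloor>)"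
    by (simp add: powr_add powr_real_of_int')
  also have "\<dots> = \<bar>x\<bar>"
    using assms by (simp add: frac_def)
  finally have "\<bar>x\<bar> = 10 powr frac (log 10 \<bar>x\<bar>) * 10 powi \<lfloor>log 10 \<bar>x\<bar>\<rfloor>" ..
  moreover have "10 powr frac (log 10 \<bar>x\<bar>) \<in> {1..<10}"
    using powr_less_mono[OF frac_lt_1, of 10 "log 10 \<bar>x\<bar>"] by (simp add: ge_one_powr_ge_zero)
  ultimately have "(THE t. t \<in> {1..<10} \<and> (\<exists>k::int. \<bar>x\<bar> = t * 10 powi k)) = 10 powr frac (log 10 \<bar>x\<bar>)"
    by (intro the1_equality significand10_ex1[OF assms]) blast
  then show ?thesis
    using assms by (simp add: significand10_def)
qed

text \<open>Translates significands into fractional parts, on which Weyl's criterion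
  operates.\<close>

lemma benford_phi_eq:
  assumes "x \<noteq> 0" "s > 0"
  shows "benford_phi s x = of_bool (frac (log 10 \<bar>x\<bar>) \<le> log 10 s)"
  using assms by (simp add: benford_phi_def significand10_eq le_log_iff)

lemma borel_measurable_benford_phi [measurable]: "benford_phi s \<in> borel_measurable borel"
proof -
  have "significand10 = (\<lambda>x. if x = 0 then 0 else 10 powr frac (log 10 \<bar>x\<bar>))"
    by (rule ext) (simp add: significand10_eq, simp add: significand10_def)
  also have "\<dots> \<in> borel_measurable borel"
    unfolding frac_def by measurable
  finally have [measurable]: "significand10 \<in> borel_measurable borel" .
  show ?thesis
    unfolding benford_phi_def by measurable
qed

lemma log_abs_prod:
  assumes "finite I" "\<And>i. i \<in> I \<Longrightarrow> x i \<noteq> (0 :: real)"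
  shows "log b \<bar>\<Prod>i\<in>I. x i\<bar> = (\<Sum>i\<in>I. log b \<bar>x i\<bar>)"
  using assms by (simp add: log_def abs_prod ln_prod sum_divide_distrib)

lemma borel_measurable_det_term_cdf:
  assumes "\<And>p q. p \<in> {1..n} \<Longrightarrow> q \<in> {1..n} \<Longrightarrow> X p q \<in> borel_measurable M"
  shows "det_term_cdf n X s \<in> borel_measurable M"
proof -
  have "det_term n X \<sigma> \<in> borel_measurable M" if "\<sigma> permutes {1..n}" for \<sigma>
    unfolding det_term_def using assms permutes_in_image[OF that]
    by (intro borel_measurable_prod) auto
  then show ?thesis
    unfolding det_term_cdf_def
    by (intro borel_measurable_times borel_measurable_const borel_measurable_sum
        measurable_compose[OF _ borel_measurable_benford_phi]) auto
qed

lemma det_term_cdf_bounds: "det_term_cdf n X s \<omega> \<in> {0..1}"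
proof -
  let ?S = "\<Sum>\<sigma> | \<sigma> permutes {1..n}. benford_phi s (det_term n X \<sigma> \<omega>)"
  have "0 \<le> ?S"
    by (intro sum_nonneg) (simp add: benford_phi_def)
  moreover have "?S \<le> (\<Sum>\<sigma> | \<sigma> permutes {1..n}. 1)"
    by (intro sum_mono) (simp add: benford_phi_def)
  ultimately show ?thesis
    by (simp add: det_term_cdf_def card_permutations field_simps)
qed

section \<open>Equidistribution of the determinant terms\<close>

text \<open>The samples are indexed by permutations, the value at \<open>\<sigma>\<close> being a
  sum of logarithms of entries. The averaged characters decay by the permutation bound, with
  \<open>r < 1\<close> independent of \<open>n\<close> because all entries share one law.\<close>

lemma equidistribution_of_determinant_terms:
  fixes M :: "nat \<Rightarrow> 'a measure" and X :: "nat \<Rightarrow> nat \<Rightarrow> nat \<Rightarrow> 'a \<Rightarrow> real"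
    and f :: "real \<Rightarrow> ennreal"
  assumes prob: "\<And>n. n \<ge> 1 \<Longrightarrow> prob_space (M n)"
    and indep: "\<And>n. n \<ge> 1 \<Longrightarrow>
          prob_space.indep_vars (M n) (\<lambda>_. borel) (\<lambda>(p, q). X n p q) ({1..n} \<times> {1..n})"
    and density: "\<And>n p q. n \<ge> 1 \<Longrightarrow> p \<in> {1..n} \<Longrightarrow> q \<in> {1..n} \<Longrightarrow>
          distributed (M n) lborel (X n p q) f"
    and s: "s \<in> {1..<10}"
  shows "(\<lambda>n. LINT \<omega>|M n. \<bar>det_term_cdf n (X n) s \<omega> - log 10 s\<bar>) \<longlonglongrightarrow> 0"
proof -
  define L where "L n j \<omega> = log 10 \<bar>X n (fst j) (snd j) \<omega>\<bar>" for n and j :: "nat \<times> nat" and \<omega>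
  define Z where "Z n \<sigma> \<omega> = (\<Sum>p\<in>{1..n}. L n (p, \<sigma> p) \<omega>)" for n \<sigma> \<omega>
  define P where "P n = {\<sigma>. \<sigma> permutes {1..n::nat}}" for n
  have P: "finite (P n)" "P n \<noteq> {}" "card (P n) = fact n" for n
    using permutes_id[of "{1..n}"]
    by (auto simp: P_def finite_permutations card_permutations simp del: permutes_id)
  have X_meas: "X n p q \<in> borel_measurable (M n)" if "n \<ge> 1" "p \<in> {1..n}" "q \<in> {1..n}" for n p q
    using distributed_measurable[OF density[OF that]] by simp
  have L_indep: "prob_space.indep_vars (M n) (\<lambda>_. borel) (L n) ({1..n} \<times> {1..n})" if "n \<ge> 1" for n
    using prob_space.indep_vars_compose2[OF prob[OF that] indep[OF that],
        of "\<lambda>_ x. log 10 \<bar>x\<bar>" "\<lambda>_. borel"]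
    by (simp add: L_def[abs_def] case_prod_unfold)
  have Z_meas: "Z n \<sigma> \<in> borel_measurable (M n)" if "n \<ge> 1" "\<sigma> \<in> P n" for n \<sigma>
    unfolding Z_def L_def using X_meas[OF that(1)] permutes_in_image[of \<sigma> "{1..n}"] that(2)
    by (intro borel_measurable_sum borel_measurable_log borel_measurable_abs) (auto simp: P_def)
  \<comment> \<open>Shifted to \<open>Suc n\<close>, as the hypotheses concern
    \<open>n \<ge> 1\<close>; \<open>LIMSEQ_imp_Suc\<close> undoes the shift at the end.\<close>
  interpret E: empirical_measures "\<lambda>n. M (Suc n)" "\<lambda>n. P (Suc n)" "\<lambda>n. Z (Suc n)"
  proof (rule empirical_measures.intro)
    show "prob_space (M (Suc n))" for n
      by (rule prob) simp
    show "Z (Suc n) \<sigma> \<in> borel_measurable (M (Suc n))" if "\<sigma> \<in> P (Suc n)" for n \<sigma>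
      using that by (intro Z_meas) simp_all
  qed (rule P)+
  have "(\<lambda>n. LINT \<omega>|M (Suc n). \<bar>E.emp n (\<lambda>t. of_bool (frac t \<le> log 10 s)) \<omega> - log 10 s\<bar>) \<longlonglongrightarrow> 0"
  proof (rule E.weyl_criterion)
    show "0 \<le> log 10 s" "log 10 s \<le> 1"
      using s by (auto simp: log_le_one_cancel_iff)
  next
    fix k :: int
    assume "k \<noteq> 0"
    define \<theta> where "\<theta> = 2 * pi * of_int k"
    \<comment> \<open>The single entry of the 1 by 1 matrix represents all others: by
      \<open>char\<close>, the coefficient depends on the common law only.\<close>
    define \<rho> where "\<rho> = cmod (LINT \<omega>|M 1. cis (\<theta> * L 1 (1, 1) \<omega>))"
    \<comment> \<open>The midpoint is positive even if \<open>\<rho>\<close> vanishes, and still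
      below 1.\<close>
    define r where "r = (1 + \<rho>) / 2"
    have char: "(LINT \<omega>|M n. cis (\<theta> * L n (p, q) \<omega>)) = (LINT x|density lborel f. cis (\<theta> * log 10 \<bar>x\<bar>))"
      if "n \<ge> 1" "p \<in> {1..n}" "q \<in> {1..n}" for n p q
    proof -
      have [measurable]: "cis \<in> borel_measurable borel"
        by (intro borel_measurable_continuous_onI continuous_intros)
      have "(LINT x|distr (M n) lborel (X n p q). cis (\<theta> * log 10 \<bar>x\<bar>))
          = (LINT \<omega>|M n. cis (\<theta> * log 10 \<bar>X n p q \<omega>\<bar>))"
        using X_meas[OF that] by (intro integral_distr) auto
      then show ?thesis
        by (simp add: L_def distributed_distr_eq_density[OF density[OF that]])
    qed
    \<comment> \<open>The frequency is divided by \<open>ln 10\<close> because the logarithm is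
      decimal.\<close>
    have "\<rho> < 1"
      using prob_space.norm_log_character_less_1[OF prob density[of 1 1 1], of "\<theta> / ln 10"] \<open>k \<noteq> 0\<close>
      by (simp add: \<rho>_def \<theta>_def L_def log_def)
    moreover have "0 \<le> \<rho>"
      by (simp add: \<rho>_def)
    ultimately have r: "0 < r" "r < 1" "\<rho> \<le> r"
      by (auto simp: r_def)
    have le: "(LINT \<omega>|M (Suc n). cmod (E.emp n (\<lambda>t. cis (\<theta> * t)) \<omega>)) \<le> sqrt (r ^ Suc n + 1 / Suc n)" for n
    proof -
      have "cmod (LINT \<omega>|M (Suc n). cis (\<theta> * L (Suc n) j \<omega>)) \<le> r" if "j \<in> {1..Suc n} \<times> {1..Suc n}" for j
        using that r(3) char[of "Suc n" "fst j" "snd j"] char[of 1 1 1] by (auto simp: \<rho>_def)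
      then have "(LINT \<omega>|M (Suc n). cmod ((\<Sum>\<sigma> | \<sigma> permutes {1..Suc n}.
            cis (\<theta> * (\<Sum>p\<in>{1..Suc n}. L (Suc n) (p, \<sigma> p) \<omega>))) /\<^sub>R fact (card {1..Suc n})))
          \<le> sqrt (r ^ card {1..Suc n} + 1 / card {1..Suc n})"
        by (intro prob_space.expectation_norm_permutation_average_le prob L_indep r(1)) auto
      then show ?thesis
        unfolding E.emp_def P(3) unfolding Z_def P_def by (simp only: card_atLeastAtMost diff_Suc_1 of_nat_fact)
    qed
    have lim: "(\<lambda>n. sqrt (r ^ Suc n + 1 / Suc n)) \<longlonglongrightarrow> sqrt (0 + 0)"
      using r LIMSEQ_Suc[OF LIMSEQ_realpow_zero[of r]] LIMSEQ_Suc[OF lim_inverse_n']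
      by (intro tendsto_real_sqrt tendsto_add) auto
    have "(\<lambda>n. LINT \<omega>|M (Suc n). cmod (E.emp n (\<lambda>t. cis (\<theta> * t)) \<omega>)) \<longlonglongrightarrow> 0"
    proof (rule Lim_null_comparison)
      show "\<forall>\<^sub>F n in sequentially. norm (LINT \<omega>|M (Suc n). cmod (E.emp n (\<lambda>t. cis (\<theta> * t)) \<omega>))
          \<le> sqrt (r ^ Suc n + 1 / Suc n)"
        using le by (intro always_eventually allI)
          (simp only: real_norm_def abs_of_nonneg[OF Bochner_Integration.integral_nonneg[OF norm_ge_zero]])
      show "(\<lambda>n. sqrt (r ^ Suc n + 1 / Suc n)) \<longlonglongrightarrow> 0"
        using lim by (simp only: add_0 real_sqrt_zero)
    qed
    then show "(\<lambda>n. LINT \<omega>|M (Suc n). cmod (E.emp n (\<lambda>t. cis (2 * pi * of_int k * t)) \<omega>)) \<longlonglongrightarrow> 0"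
      by (simp add: \<theta>_def)
  qed
  moreover have "(LINT \<omega>|M (Suc n). \<bar>E.emp n (\<lambda>t. of_bool (frac t \<le> log 10 s)) \<omega> - log 10 s\<bar>)
      = (LINT \<omega>|M (Suc n). \<bar>det_term_cdf (Suc n) (X (Suc n)) s \<omega> - log 10 s\<bar>)" for n
  proof (rule integral_cong_AE)
    let ?N = "Suc n"
    let ?\<phi> = "\<lambda>t. of_bool (frac t \<le> log 10 s) :: real"
    have [measurable]: "?\<phi> \<in> borel_measurable borel"
      by (simp add: frac_def)
    show "(\<lambda>\<omega>. \<bar>E.emp n ?\<phi> \<omega> - log 10 s\<bar>) \<in> borel_measurable (M ?N)"
      using E.borel_measurable_emp[of ?\<phi> n] by measurable
    show "(\<lambda>\<omega>. \<bar>det_term_cdf ?N (X ?N) s \<omega> - log 10 s\<bar>) \<in> borel_measurable (M ?N)"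
      using borel_measurable_det_term_cdf[of ?N "X ?N" "M ?N" s] X_meas[of ?N] by simp
    \<comment> \<open>Zero entries, at which the logarithm need not turn products into sums, are
      excluded almost surely since a point is Lebesgue null.\<close>
    have "AE \<omega> in M ?N. X ?N p q \<omega> \<noteq> 0" if "p \<in> {1..?N}" "q \<in> {1..?N}" for p q
    proof -
      have "AE x in lborel. x \<noteq> (0 :: real)"
        by (rule AE_lborel_singleton)
      then show ?thesis
        using prob_space.distributed_AE2[OF prob density[OF _ that], of "\<lambda>x. x \<noteq> 0"] by auto
    qed
    then have "AE \<omega> in M ?N. \<forall>p\<in>{1..?N}. \<forall>q\<in>{1..?N}. X ?N p q \<omega> \<noteq> 0"
      by (intro AE_finite_allI) auto
    then show "AE \<omega> in M ?N. \<bar>E.emp n ?\<phi> \<omega> - log 10 s\<bar> = \<bar>det_term_cdf ?N (X ?N) s \<omega> - log 10 s\<bar>"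
    proof eventually_elim
      case (elim \<omega>)
      have "?\<phi> (Z ?N \<sigma> \<omega>) = benford_phi s (det_term ?N (X ?N) \<sigma> \<omega>)" if "\<sigma> \<in> P ?N" for \<sigma>
      proof -
        have nz: "X ?N p (\<sigma> p) \<omega> \<noteq> 0" if "p \<in> {1..?N}" for p
          using elim that permutes_in_image[of \<sigma> "{1..?N}" p] \<open>\<sigma> \<in> P ?N\<close> by (auto simp: P_def)
        have "Z ?N \<sigma> \<omega> = log 10 \<bar>det_term ?N (X ?N) \<sigma> \<omega>\<bar>"
          unfolding Z_def L_def det_term_def fst_conv snd_conv
          using nz by (intro log_abs_prod[symmetric]) auto
        moreover have "det_term ?N (X ?N) \<sigma> \<omega> \<noteq> 0"
          unfolding det_term_def using nz by (subst prod_zero_iff) auto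
        ultimately show ?thesis
          using s by (simp add: benford_phi_eq)
      qed
      then have "E.emp n ?\<phi> \<omega> = det_term_cdf ?N (X ?N) s \<omega>"
        unfolding E.emp_def det_term_cdf_def P(3) P_def[symmetric]
        by (simp add: divide_inverse del: fact_Suc)
      then show ?case
        by simp
    qed
  qed
  ultimately show ?thesis
    by (intro LIMSEQ_imp_Suc[where f="\<lambda>n. LINT \<omega>|M n. \<bar>det_term_cdf n (X n) s \<omega> - log 10 s\<bar>"]) simp
qed

section \<open>Mean and variance\<close>

text \<open>Both limits follow from convergence in mean to \<open>log 10 s\<close>: the error of the
  expectation is at most the mean distance, and so is the variance, because the random values and
  \<open>log 10 s\<close> lie in \<open>[0, 1]\<close>.\<close>

theorem theorem1p16:
  fixes f :: "real \<Rightarrow> real"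
    and M :: "nat \<Rightarrow> 'a measure"
    and A :: "nat \<Rightarrow> nat \<Rightarrow> nat \<Rightarrow> 'a \<Rightarrow> real"
    and S :: "nat \<Rightarrow> complex"
    and s :: real
  assumes f_continuous: "continuous_on UNIV f"
    and f_nonneg: "\<And>x. 0 \<le> f x"
    and f_density: "(\<integral>\<^sup>+x. ennreal (f x) \<partial>lborel) = 1"
    and mellin_sum: "\<forall>\<^sub>F N in sequentially.
          nonzero_int_sums
            (\<lambda>l. \<Prod>m::nat=1..N. mellin f (1 - 2 * of_real pi * \<i> * of_int l / of_real (ln 10)))
            (S N)"
    and mellin_lim: "S \<longlonglongrightarrow> 0"
    and prob: "\<And>n. n \<ge> 1 \<Longrightarrow> prob_space (M n)"
    and indep: "\<And>n. n \<ge> 1 \<Longrightarrow>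
          prob_space.indep_vars (M n) (\<lambda>_. borel) (\<lambda>(p, q). A n p q) ({1..n} \<times> {1..n})"
    and entries_density: "\<And>n p q. n \<ge> 1 \<Longrightarrow> p \<in> {1..n} \<Longrightarrow> q \<in> {1..n} \<Longrightarrow>
          distributed (M n) lborel (A n p q) (\<lambda>x. ennreal (f x))"
    and s: "s \<in> {1..<10}"
  shows "(\<lambda>n. prob_space.expectation (M n) (det_term_cdf n (A n) s)) \<longlonglongrightarrow> log 10 s
       \<and> (\<lambda>n. prob_space.variance (M n) (det_term_cdf n (A n) s)) \<longlonglongrightarrow> 0"
proof -
  let ?P = "\<lambda>n. det_term_cdf n (A n) s" and ?c = "log 10 s"
  have lim: "(\<lambda>n. LINT \<omega>|M n. \<bar>?P n \<omega> - ?c\<bar>) \<longlonglongrightarrow> 0"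
    using equidistribution_of_determinant_terms[OF prob indep entries_density s] .
  have c: "0 \<le> ?c" "?c \<le> 1"
    using s by (auto simp: log_le_one_cancel_iff)
  \<comment> \<open>Restricted to \<open>n \<ge> 1\<close>, since \<open>M 0\<close> need not be a
    probability space.\<close>
  have bounds: "\<bar>(LINT \<omega>|M n. ?P n \<omega>) - ?c\<bar> \<le> (LINT \<omega>|M n. \<bar>?P n \<omega> - ?c\<bar>)"
    "0 \<le> prob_space.variance (M n) (?P n)"
    "prob_space.variance (M n) (?P n) \<le> (LINT \<omega>|M n. \<bar>?P n \<omega> - ?c\<bar>)" if "n \<ge> 1" for n
  proof -
    interpret prob_space "M n"
      by (rule prob[OF that])
    have meas [measurable]: "?P n \<in> borel_measurable (M n)"
      using distributed_measurable[OF entries_density[OF that]]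
      by (intro borel_measurable_det_term_cdf) simp
    have P_range: "0 \<le> ?P n \<omega>" "?P n \<omega> \<le> 1" for \<omega>
      using det_term_cdf_bounds[of n "A n" s \<omega>] by auto
    have int: "integrable (M n) g" if "g \<in> borel_measurable (M n)" "\<And>\<omega>. \<bar>g \<omega>\<bar> \<le> 1"
      for g :: "'a \<Rightarrow> real"
      by (rule integrable_const_bound[of _ 1]) (use that in auto)
    have dist: "\<bar>?P n \<omega> - ?c\<bar> \<le> 1" for \<omega>
      using P_range[of \<omega>] c by linarith
    have int_P: "integrable (M n) (?P n)" "integrable (M n) (\<lambda>\<omega>. ?P n \<omega> ^ 2)"
      "integrable (M n) (\<lambda>\<omega>. \<bar>?P n \<omega> - ?c\<bar>)" "integrable (M n) (\<lambda>\<omega>. (?P n \<omega> - ?c) ^ 2)"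
      by (rule int; use P_range dist in \<open>auto simp: power_le_one abs_square_le_1\<close>)+
    have "(LINT \<omega>|M n. ?P n \<omega>) - ?c = (LINT \<omega>|M n. ?P n \<omega> - ?c)"
      using int_P prob_space by simp
    then show "\<bar>(LINT \<omega>|M n. ?P n \<omega>) - ?c\<bar> \<le> (LINT \<omega>|M n. \<bar>?P n \<omega> - ?c\<bar>)"
      by (simp add: integral_abs_bound)
    show "0 \<le> variance (?P n)"
      by (rule variance_positive)
    \<comment> \<open>The second moment about \<open>?c\<close> exceeds the variance by the square
      of the bias.\<close>
    have "(LINT \<omega>|M n. (?P n \<omega> - ?c) ^ 2) = (LINT \<omega>|M n. ?P n \<omega> ^ 2 - 2 * ?c * ?P n \<omega> + ?c ^ 2)"
      by (simp add: power2_diff algebra_simps)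
    also have "\<dots> = variance (?P n) + (expectation (?P n) - ?c) ^ 2"
      using int_P prob_space by (simp add: variance_eq power2_diff) (simp add: power2_eq_square)
    finally have "variance (?P n) \<le> (LINT \<omega>|M n. (?P n \<omega> - ?c) ^ 2)"
      by simp
    \<comment> \<open>Distances of at most 1 do not grow when squared.\<close>
    also have "\<dots> \<le> (LINT \<omega>|M n. \<bar>?P n \<omega> - ?c\<bar>)"
    proof (rule integral_mono[OF int_P(4,3)])
      fix \<omega>
      show "(?P n \<omega> - ?c) ^ 2 \<le> \<bar>?P n \<omega> - ?c\<bar>"
        using mult_left_le[OF dist[of \<omega>] abs_ge_zero[of "?P n \<omega> - ?c"]]
        by (simp add: power2_eq_square flip: abs_mult)
    qed
    finally show "variance (?P n) \<le> (LINT \<omega>|M n. \<bar>?P n \<omega> - ?c\<bar>)" .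
  qed
  have "(\<lambda>n. (LINT \<omega>|M n. ?P n \<omega>) - ?c) \<longlonglongrightarrow> 0"
    by (rule Lim_null_comparison[OF _ lim]) (use bounds(1) in \<open>auto intro!: eventually_sequentiallyI[of 1]\<close>)
  then have "(\<lambda>n. LINT \<omega>|M n. ?P n \<omega>) \<longlonglongrightarrow> ?c"
    by (rule LIM_zero_cancel)
  moreover have "(\<lambda>n. prob_space.variance (M n) (?P n)) \<longlonglongrightarrow> 0"
    by (rule tendsto_sandwich[OF _ _ tendsto_const lim])
      (use bounds(2,3) in \<open>auto intro!: eventually_sequentiallyI[of 1]\<close>)
  ultimately show ?thesis
    by blast
qed

end
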